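(* Let $X$ be a Tychonoff space such that $C_p(X)$ is strongly sequentially separable. Then $C_p(X)$ is an $s_{\mathbb{R}}$-space, and the following conditions are equivalent: (i) $X^n$ is Lindelöf for each $n\in\omega$; (ii) $C_p(X)$ has countable tightness; (iii) $C_p(X)$ is Fréchet–Urysohn.
   Context: $C_p(X)$ is the space of continuous real-valued functions on $X$ with the topology of pointwise convergence. A space $Z$ is strongly sequentially separable if $Z$ is separable and each countable dense subset $D$ of $Z$ is sequentially dense, i.e., every point of $Z$ is the limit of a sequence of points of $D$. A function $f:Z\to\mathbb{R}$ is $s$-continuous if its restriction to each convergent sequence in $Z$ (together with its limit) is continuous; $Z$ is an $s_{\mathbb{R}}$-space if every $s$-continuous function $f:Z\to\mathbb{R}$ is continuous. $Z$ is Fréchet–Urysohn if whenever $x\in\overline{A}$, $A\subseteq Z$, there is a sequence in $A$ converging to $x$; $Z$ has countable tightness if whenever $x\in\overline{A}$ there is a countable $B\subseteq A$ with $x\in\overline{B}$. *)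

theory Defs
  imports "HOL-Analysis.Analysis"
begin

definition tychonoff_space :: "'a topology \<Rightarrow> bool" where
  "tychonoff_space X \<longleftrightarrow> t1_space X \<and> completely_regular_space X"

text \<open>The points of \<^term>\<open>powertop_real (topspace X)\<close> are the functions that are
  \<^term>\<open>undefined\<close> outside \<^term>\<open>topspace X\<close>, so each real-valued function on the space
  has exactly one representative; see \<open>topspace_Cp\<close> below.\<close>

definition Cp :: "'a topology \<Rightarrow> ('a \<Rightarrow> real) topology" where
  "Cp X = subtopology (powertop_real (topspace X)) {f. continuous_map X euclideanreal f}"

lemma topspace_Cp:
  "topspace (Cp X) = {f \<in> extensional (topspace X). continuous_map X euclideanreal f}"
  by (auto simp: Cp_def PiE_def)

lemma limitin_Cp_sequentially:
  assumes "range \<sigma> \<subseteq> topspace (Cp X)" and "f \<in> topspace (Cp X)"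
  shows "limitin (Cp X) \<sigma> f sequentially \<longleftrightarrow> (\<forall>x\<in>topspace X. (\<lambda>n. \<sigma> n x) \<longlonglongrightarrow> f x)"
proof -
  have "\<sigma> n \<in> extensional (topspace X)" "continuous_map X euclideanreal (\<sigma> n)" for n
    using assms(1) by (auto simp: topspace_Cp)
  then show ?thesis
    using assms(2) unfolding topspace_Cp Cp_def
    by (simp add: limitin_subtopology limitin_componentwise PiE_def)
qed

definition sequentially_dense_in :: "'a topology \<Rightarrow> 'a set \<Rightarrow> bool" where
  "sequentially_dense_in Z D \<longleftrightarrow> D \<subseteq> topspace Z \<and>
     (\<forall>z\<in>topspace Z. \<exists>\<sigma>. range \<sigma> \<subseteq> D \<and> limitin Z \<sigma> z sequentially)"

definition strongly_sequentially_separable :: "'a topology \<Rightarrow> bool" where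
  "strongly_sequentially_separable Z \<longleftrightarrow> separable_space Z \<and>
     (\<forall>D. D \<subseteq> topspace Z \<and> countable D \<and> Z closure_of D = topspace Z
        \<longrightarrow> sequentially_dense_in Z D)"

definition s_continuous :: "'a topology \<Rightarrow> ('a \<Rightarrow> real) \<Rightarrow> bool" where
  "s_continuous Z f \<longleftrightarrow>
     (\<forall>\<sigma> z. range \<sigma> \<subseteq> topspace Z \<and> limitin Z \<sigma> z sequentially
        \<longrightarrow> continuous_map (subtopology Z (insert z (range \<sigma>))) euclideanreal f)"

definition s_R_space :: "'a topology \<Rightarrow> bool" where
  "s_R_space Z \<longleftrightarrow> (\<forall>f. s_continuous Z f \<longrightarrow> continuous_map Z euclideanreal f)"

definition Frechet_Urysohn_space :: "'a topology \<Rightarrow> bool" where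
  "Frechet_Urysohn_space Z \<longleftrightarrow>
     (\<forall>A x. A \<subseteq> topspace Z \<and> x \<in> Z closure_of A
        \<longrightarrow> (\<exists>\<sigma>. range \<sigma> \<subseteq> A \<and> limitin Z \<sigma> x sequentially))"

definition countable_tightness :: "'a topology \<Rightarrow> bool" where
  "countable_tightness Z \<longleftrightarrow>
     (\<forall>A x. A \<subseteq> topspace Z \<and> x \<in> Z closure_of A
        \<longrightarrow> (\<exists>B. B \<subseteq> A \<and> countable B \<and> x \<in> Z closure_of B))"

definition finite_power :: "'a topology \<Rightarrow> nat \<Rightarrow> (nat \<Rightarrow> 'a) topology" where
  "finite_power X n = product_topology (\<lambda>i. X) {..<n}"

end

theory Submission
  imports Defs
begin

text \<open>Everything rests on one consequence of strong sequential separability,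
  \<open>Cp_closure_of_countable_sequence\<close>: a point \<open>f\<close> in the closure of a
  countable set \<open>B\<close> is the limit of a sequence in \<open>B\<close>. For infinite
  \<open>X\<close>, \<open>B\<close> and a countable dense set \<open>D\<close> are merged into a
  countable dense set of functions, each carrying some \<open>b\<close> from \<open>B\<close> and an
  index \<open>n\<close>. Sequential density gives a sequence of them converging to 0, built so that
  the functions \<open>b\<close> it carries converge to \<open>f\<close>.

  Hence an s-continuous function respects closures of countable sets, and separability then makes it
  continuous (\<open>s_R_space_Cp\<close>). Under countable tightness each closure point of a set
  lies in the closure of a countable subset, so the same lemma yields the Frechet-Urysohn property;
  the converse holds in any space.

  The equivalence of tightness with the Lindelof property of all \<open>X^n\<close> is the
  Arhangel'skii-Pytkeev theorem (\<open>countable_tightness_Cp\<close>,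
  \<open>Lindelof_finite_power\<close>). Basic neighbourhoods in \<open>Cp X\<close> test finitely
  many points, that is, one point of some \<open>X^n\<close>, so approximation in
  \<open>Cp X\<close> translates into covering \<open>X^n\<close>.\<close>

section \<open>Neighbourhoods and closures in \<open>Cp X\<close>\<close>

lemma Cp_continuous: "f \<in> topspace (Cp X) \<Longrightarrow> continuous_map X euclideanreal f"
  by (simp add: topspace_Cp)

lemma restrict_in_Cp:
  assumes "continuous_map X euclideanreal f"
  shows "restrict f (topspace X) \<in> topspace (Cp X)"
  using continuous_map_eq[OF assms, of "restrict f (topspace X)"] by (simp add: topspace_Cp)

lemma continuous_map_Cp_eval:
  assumes "x \<in> topspace X"
  shows "continuous_map (Cp X) euclideanreal (\<lambda>f. f x)"
  unfolding Cp_def using assms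
  by (intro continuous_map_from_subtopology continuous_map_product_coordinates)

lemma openin_Cp_basic:
  assumes "finite K" "K \<subseteq> topspace X"
  shows "openin (Cp X) {g \<in> topspace (Cp X). \<forall>x\<in>K. \<bar>g x - f x\<bar> < e}"
  using assms
proof (induction K)
  case empty
  then show ?case by simp
next
  case (insert y K)
  have "openin (Cp X) {g \<in> topspace (Cp X). g y \<in> ball (f y) e}"
    using insert.prems by (intro openin_continuous_map_preimage[OF continuous_map_Cp_eval]) auto
  moreover have "openin (Cp X) {g \<in> topspace (Cp X). \<forall>x\<in>K. \<bar>g x - f x\<bar> < e}"
    using insert by simp
  ultimately have "openin (Cp X) ({g \<in> topspace (Cp X). g y \<in> ball (f y) e} \<inter>
      {g \<in> topspace (Cp X). \<forall>x\<in>K. \<bar>g x - f x\<bar> < e})"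
    by (rule openin_Int)
  then show ?case
    by (rule back_subst[of "openin (Cp X)"]) (auto simp: dist_real_def)
qed

lemma finite_uniform_radius:
  fixes r :: "'a \<Rightarrow> real"
  assumes "finite K" "\<And>x. x \<in> K \<Longrightarrow> r x > 0"
  obtains e where "e > 0" "\<And>x. x \<in> K \<Longrightarrow> e \<le> r x"
proof
  \<comment> \<open>The extra element 1 keeps \<open>Min\<close> meaningful when \<open>K\<close> is
    empty.\<close>
  show "Min (insert 1 (r ` K)) > 0" using assms by auto
  show "Min (insert 1 (r ` K)) \<le> r x" if "x \<in> K" for x using assms that by auto
qed

text \<open>A basic open set of the product restricts only finitely many coordinates, and the least
  of the finitely many radii serves them all. Closure arguments below go through this epsilon
  form.\<close>

lemma in_closure_of_Cp:
  assumes "A \<subseteq> topspace (Cp X)"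
  shows "f \<in> Cp X closure_of A \<longleftrightarrow> f \<in> topspace (Cp X) \<and>
    (\<forall>K e. finite K \<and> K \<subseteq> topspace X \<and> 0 < e \<longrightarrow> (\<exists>a\<in>A. \<forall>x\<in>K. \<bar>a x - f x\<bar> < e))"
    (is "_ \<longleftrightarrow> _ \<and> ?R")
proof (intro iffI conjI allI impI)
  assume "f \<in> Cp X closure_of A"
  then show f: "f \<in> topspace (Cp X)" by (simp add: in_closure_of)
  fix K :: "'a set" and e :: real
  assume K: "finite K \<and> K \<subseteq> topspace X \<and> 0 < e"
  let ?T = "{g \<in> topspace (Cp X). \<forall>x\<in>K. \<bar>g x - f x\<bar> < e}"
  have "f \<in> ?T" "openin (Cp X) ?T" using K f openin_Cp_basic by auto
  then have "\<exists>y. y \<in> A \<and> y \<in> ?T"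
    using \<open>f \<in> Cp X closure_of A\<close>[unfolded in_closure_of, THEN conjunct2, rule_format, of ?T] by simp
  then show "\<exists>a\<in>A. \<forall>x\<in>K. \<bar>a x - f x\<bar> < e" by blast
next
  assume "f \<in> topspace (Cp X) \<and> ?R"
  then have f: "f \<in> topspace (Cp X)" and R: ?R by auto
  show "f \<in> Cp X closure_of A"
    unfolding in_closure_of
  proof (intro conjI allI impI f)
    fix T assume T: "f \<in> T \<and> openin (Cp X) T"
    then obtain T' where T': "openin (powertop_real (topspace X)) T'"
      "T = T' \<inter> {f. continuous_map X euclideanreal f}"
      unfolding Cp_def openin_subtopology by blast
    have fT': "f \<in> T'" using T T'(2) by blast
    then obtain U where U: "finite {i \<in> topspace X. U i \<noteq> UNIV}" "\<forall>i\<in>topspace X. open (U i)"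
      "f \<in> Pi\<^sub>E (topspace X) U" "Pi\<^sub>E (topspace X) U \<subseteq> T'"
      using T'(1)[unfolded openin_product_topology_alt, THEN bspec, OF fT'] by auto
    let ?K = "{i \<in> topspace X. U i \<noteq> UNIV}"
    have "\<exists>r>0. ball (f x) r \<subseteq> U x" if "x \<in> ?K" for x
    proof -
      have "open (U x)" "f x \<in> U x" using that U(2,3) by (auto simp: PiE_iff)
      then show ?thesis by (meson openE)
    qed
    then obtain r where r: "\<And>x. x \<in> ?K \<Longrightarrow> r x > 0 \<and> ball (f x) (r x) \<subseteq> U x"
      by metis
    obtain e where e: "e > 0" "\<And>x. x \<in> ?K \<Longrightarrow> e \<le> r x"
      using finite_uniform_radius[OF U(1), of r] r by blast
    have "?K \<subseteq> topspace X" by blast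
    then obtain a where a: "a \<in> A" "\<forall>x\<in>?K. \<bar>a x - f x\<bar> < e"
      using R U(1) e(1) by meson
    have "a x \<in> U x" if "x \<in> topspace X" for x
    proof (cases "x \<in> ?K")
      case True
      then have "a x \<in> ball (f x) (r x)" using a(2) e(2)[OF True] 
        by (auto simp: dist_real_def)
      then show ?thesis using r[OF True] by blast
    qed (use that in auto)
    moreover have "a \<in> extensional (topspace X)" "continuous_map X euclideanreal a"
      using a assms by (auto simp: topspace_Cp)
    ultimately have "a \<in> Pi\<^sub>E (topspace X) U" "continuous_map X euclideanreal a"
      by (auto simp: PiE_iff)
    then have "a \<in> T" using U(4) T'(2) by blast
    then show "\<exists>y. y \<in> A \<and> y \<in> T" using a(1) by blast
  qed
qed

text \<open>Complete regularity treats one point at a time. The product of the separating functions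
  of the points of \<open>K\<close> vanishes on \<open>K\<close> and is 1 on \<open>S\<close>; its
  complement to 1 is the required function.\<close>

lemma completely_regular_finite_separation:
  assumes "completely_regular_space X" "closedin X S" "finite K" "K \<subseteq> topspace X" "K \<inter> S = {}"
  obtains u :: "'a \<Rightarrow> real" where "continuous_map X euclideanreal u"
    "\<And>x. x \<in> K \<Longrightarrow> u x = 1" "\<And>x. x \<in> S \<Longrightarrow> u x = 0"
proof -
  have "\<exists>f::'a\<Rightarrow>real. continuous_map X euclideanreal f \<and> f k = 0 \<and> f ` S \<subseteq> {1}" if "k \<in> K" for k
    using assms that unfolding completely_regular_space_alt by blast
  then obtain f :: "'a \<Rightarrow> 'a \<Rightarrow> real" where f: "\<And>k. k \<in> K \<Longrightarrow> continuous_map X euclideanreal (f k)"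
    "\<And>k. k \<in> K \<Longrightarrow> f k k = 0" "\<And>k x. k \<in> K \<Longrightarrow> x \<in> S \<Longrightarrow> f k x = 1"
    by (metis image_subset_iff singletonD)
  show thesis
  proof
    show "continuous_map X euclideanreal (\<lambda>x. 1 - (\<Prod>k\<in>K. f k x))"
      using f(1) assms by (intro continuous_intros) auto
    show "1 - (\<Prod>k\<in>K. f k x) = 1" if "x \<in> K" for x
      using prod_zero[OF assms(3), of "\<lambda>k. f k x"] f(2) that by auto
    show "1 - (\<Prod>k\<in>K. f k x) = 0" if "x \<in> S" for x
      using f(3) that by simp
  qed
qed

section \<open>Sequences from countable sets\<close>

text \<open>If \<open>d\<close> approximates \<open>g\<close> on \<open>K\<close> and \<open>b\<close> is close enough to \<open>f\<close> on \<open>K\<close>, then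
  \<open>d (1 - m) + m\<close> with \<open>m = min 1 (n \<bar>b - f\<bar>)\<close> still approximates \<open>g\<close> on \<open>K\<close>, but it equals
  \<open>1\<close> wherever \<open>n \<bar>b - f\<bar> \<ge> 1\<close>. Thus these functions are dense, while smallness at \<open>x\<close>
  forces \<open>\<bar>b x - f x\<bar> < 1 / n\<close>. Requiring \<open>d (a n) > 1\<close> forces \<open>n\<close> to infinity along
  any sequence of them converging to \<open>0\<close>.\<close>

definition penalized :: "'a topology \<Rightarrow> ('a \<Rightarrow> real) \<Rightarrow> ('a \<Rightarrow> real) \<Rightarrow> nat \<Rightarrow> ('a \<Rightarrow> real) \<Rightarrow> 'a \<Rightarrow> real"
  where "penalized X f b n d = (\<lambda>x\<in>topspace X.
    d x * (1 - min 1 (real n * \<bar>b x - f x\<bar>)) + min 1 (real n * \<bar>b x - f x\<bar>))"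

lemma penalized_in_Cp:
  assumes "f \<in> topspace (Cp X)" "b \<in> topspace (Cp X)" "d \<in> topspace (Cp X)"
  shows "penalized X f b n d \<in> topspace (Cp X)"
  unfolding penalized_def using assms[THEN Cp_continuous]
  by (intro restrict_in_Cp continuous_intros) auto

text \<open>The condition \<open>d (a n) > 1\<close> does not obstruct approximation on a finite
  \<open>K\<close>, since \<open>n\<close> can be chosen with \<open>a n\<close> outside
  \<open>K\<close>. The choices are made in the order \<open>n\<close>, \<open>d\<close>,
  \<open>b\<close>, so that the closeness of \<open>b\<close> to \<open>f\<close> may depend on
  \<open>n\<close> and on the size of \<open>d\<close> on \<open>K\<close>.\<close>

lemma penalized_dense:
  assumes X: "tychonoff_space X"
    and D: "D \<subseteq> topspace (Cp X)" "Cp X closure_of D = topspace (Cp X)"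
    and B: "B \<subseteq> topspace (Cp X)" "f \<in> Cp X closure_of B"
    and a: "inj a" "range a \<subseteq> topspace X"
  shows "Cp X closure_of {penalized X f b n d |b n d. b \<in> B \<and> d \<in> D \<and> d (a n) > 1}
    = topspace (Cp X)" (is "_ closure_of ?E = _")
proof
  have f: "f \<in> topspace (Cp X)" using B(2) by (simp add: in_closure_of)
  have E: "?E \<subseteq> topspace (Cp X)" using f B(1) D(1) by (auto intro!: penalized_in_Cp)
  show "Cp X closure_of ?E \<subseteq> topspace (Cp X)" by (rule closure_of_subset_topspace)
  show "topspace (Cp X) \<subseteq> Cp X closure_of ?E"
  proof
    fix g assume g: "g \<in> topspace (Cp X)"
    have "\<exists>h\<in>?E. \<forall>x\<in>K. \<bar>h x - g x\<bar> < e" if K: "finite K" "K \<subseteq> topspace X" "0 < e" for K e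
    proof -
      obtain n where n: "a n \<notin> K"
        using K(1) range_inj_infinite[OF a(1)] by (meson finite_subset image_subsetI)
      have "closedin X K" using X K unfolding tychonoff_space_def t1_space_closedin_finite by blast
      then obtain u :: "'a \<Rightarrow> real" where u: "continuous_map X euclideanreal u" "u (a n) = 1"
        "\<And>x. x \<in> K \<Longrightarrow> u x = 0"
        using X a n completely_regular_finite_separation[of X K "{a n}"]
        unfolding tychonoff_space_def by auto
      \<comment> \<open>\<open>h\<close> agrees with \<open>g\<close> on \<open>K\<close> and takes
        the value 2 at \<open>a n\<close>, so that approximating it there within 1 forces
        \<open>d (a n) > 1\<close>.\<close>
      define h where "h = (\<lambda>x\<in>topspace X. g x + (2 - g (a n)) * u x)"
      have "h \<in> topspace (Cp X)"
        unfolding h_def using u(1) Cp_continuous[OF g] by (intro restrict_in_Cp continuous_intros) auto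
      then have "h \<in> Cp X closure_of D" using D by simp
      moreover have "finite (insert (a n) K)" "insert (a n) K \<subseteq> topspace X" "0 < min (e/2) 1"
        using K a by auto
      ultimately obtain d where d: "d \<in> D" "\<forall>x\<in>insert (a n) K. \<bar>d x - h x\<bar> < min (e/2) 1"
        unfolding in_closure_of_Cp[OF D(1)] by blast
      have "h (a n) = 2" using u(2) a by (auto simp: h_def)
      then have dn: "d (a n) > 1" using d(2) by auto
      have dg: "\<bar>d x - g x\<bar> < e/2" if "x \<in> K" for x
      proof -
        have "h x = g x" using that K u(3) by (auto simp: h_def)
        then show ?thesis using d(2) that by auto
      qed
      define M where "M = (\<Sum>x\<in>K. \<bar>d x\<bar>)"
      have M: "M \<ge> 0" "\<And>x. x \<in> K \<Longrightarrow> \<bar>d x\<bar> \<le> M"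
        unfolding M_def using K(1) by (auto intro: sum_nonneg member_le_sum)
      \<comment> \<open>Chosen so that the bound \<open>(n + 1) * \<delta> * (1 + M)\<close> on the
        change caused by the penalty equals \<open>e / 2\<close>; \<open>n + 1\<close> instead of
        \<open>n\<close> covers \<open>n = 0\<close>.\<close>
      define \<delta> where "\<delta> = e / (2 * (real n + 1) * (1 + M))"
      have \<delta>: "\<delta> > 0" using K(3) M by (simp add: \<delta>_def)
      then obtain b where b: "b \<in> B" "\<forall>x\<in>K. \<bar>b x - f x\<bar> < \<delta>"
        using B(2) K unfolding in_closure_of_Cp[OF B(1)] by blast
      have "\<bar>penalized X f b n d x - g x\<bar> < e" if x: "x \<in> K" for x
      proof -
        define m where "m = min 1 (real n * \<bar>b x - f x\<bar>)"
        have m0: "m \<ge> 0" by (simp add: m_def)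
        have "m \<le> real n * \<bar>b x - f x\<bar>" by (simp add: m_def)
        also have "\<dots> \<le> (real n + 1) * \<delta>" using b(2) x \<delta> by (intro mult_mono) auto
        finally have m: "m \<le> (real n + 1) * \<delta>" .
        have "penalized X f b n d x - d x = m * (1 - d x)"
          using x K(2) by (auto simp: penalized_def m_def algebra_simps)
        then have "\<bar>penalized X f b n d x - d x\<bar> = m * \<bar>1 - d x\<bar>" using m0 by (simp add: abs_mult)
        also have "\<dots> \<le> ((real n + 1) * \<delta>) * (1 + M)"
          using m m0 M(2)[OF x] M(1) \<delta> by (intro mult_mono) auto
        also have "\<dots> = e / 2" using M(1) by (simp add: \<delta>_def divide_simps)
        finally show ?thesis using dg[OF x] by linarith
      qed
      then show ?thesis using b(1) d(1) dn by blast
    qed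
    then show "g \<in> Cp X closure_of ?E"
      unfolding in_closure_of_Cp[OF E] using g by blast
  qed
qed

text \<open>The penalized functions form a countable dense set, so some sequence of them tends to 0.
  Being below 1 at \<open>x\<close> keeps the penalty at \<open>x\<close> unsaturated, and being
  below 1 at each \<open>a n\<close> drives the index to infinity; together these force
  \<open>b j x\<close> to tend to \<open>f x\<close>.\<close>

lemma Cp_closure_of_countable_sequence:
  assumes X: "tychonoff_space X" and sss: "strongly_sequentially_separable (Cp X)"
    and B: "B \<subseteq> topspace (Cp X)" "countable B" "f \<in> Cp X closure_of B"
  shows "\<exists>\<sigma>. range \<sigma> \<subseteq> B \<and> limitin (Cp X) \<sigma> f sequentially"
proof -
  have f: "f \<in> topspace (Cp X)" using B(3) by (simp add: in_closure_of)
  \<comment> \<open>The decoding criterion common to both cases: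
    \<open>\<bar>b j x - f x\<bar> < 1 / N j\<close> eventually, with \<open>N j\<close> tending to
    infinity.\<close>
  have lim: "\<exists>\<sigma>. range \<sigma> \<subseteq> B \<and> limitin (Cp X) \<sigma> f sequentially"
    if N: "filterlim N at_top sequentially" and b: "\<And>j::nat. b j \<in> B"
      and ev: "\<And>x. x \<in> topspace X \<Longrightarrow> \<forall>\<^sub>F j in sequentially. real (N j) * \<bar>b j x - f x\<bar> < 1"
    for N b
  proof (intro exI conjI)
    show "range b \<subseteq> B" using b by auto
    have "(\<lambda>j. b j x) \<longlonglongrightarrow> f x" if x: "x \<in> topspace X" for x
    proof (rule tendstoI)
      fix e :: real assume e: "0 < e"
      obtain k :: nat where k: "1 / e < real k" using reals_Archimedean2 by blast
      have "\<forall>\<^sub>F j in sequentially. k \<le> N j" using N by (simp add: filterlim_at_top)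
      then show "\<forall>\<^sub>F j in sequentially. dist (b j x) (f x) < e"
        using ev[OF x]
      proof eventually_elim
        case (elim j)
        have "1 / e < real (N j)" using k elim(1) by linarith
        then have Ne: "1 < real (N j) * e" using e by (simp add: field_simps)
        then have "real (N j) * \<bar>b j x - f x\<bar> < real (N j) * e" using elim(2) by linarith
        then show ?case by (simp add: dist_real_def mult_less_cancel_left)
      qed
    qed
    then show "limitin (Cp X) b f sequentially"
      using limitin_Cp_sequentially[of b X f] f b B(1) by blast
  qed
  show ?thesis
  proof (cases "finite (topspace X)")
    \<comment> \<open>A finite \<open>X\<close> has no injective sequence \<open>a\<close>, but here
      the whole space is an admissible finite test set, so \<open>b j\<close> can be chosen
      directly.\<close>
    case True
    have "\<exists>b\<in>B. \<forall>x\<in>topspace X. \<bar>b x - f x\<bar> < 1 / (real j + 1)" for j :: nat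
      using B(3) True unfolding in_closure_of_Cp[OF B(1)] by auto
    then obtain b where b: "\<And>j::nat. b j \<in> B"
      "\<And>j x. x \<in> topspace X \<Longrightarrow> \<bar>b j x - f x\<bar> < 1 / (real j + 1)" by metis
    have "real j * \<bar>b j x - f x\<bar> < 1" if "x \<in> topspace X" for j x
    proof -
      have "(real j + 1) * \<bar>b j x - f x\<bar> < 1" using b(2)[OF that, of j] by (simp add: field_simps)
      then show ?thesis using abs_ge_zero[of "b j x - f x"] unfolding distrib_right mult_1 by linarith
    qed
    then show ?thesis using lim[of "\<lambda>j. j" b] b(1) by (simp add: filterlim_ident)
  next
    case False
    then obtain a :: "nat \<Rightarrow> 'a" where a: "inj a" "range a \<subseteq> topspace X"
      using infinite_countable_subset by blast
    obtain D where D: "countable D" "D \<subseteq> topspace (Cp X)" "Cp X closure_of D = topspace (Cp X)"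
      using sss unfolding strongly_sequentially_separable_def separable_space_def by blast
    let ?E = "{penalized X f b n d |b n d. b \<in> B \<and> d \<in> D \<and> d (a n) > 1}"
    have "countable (\<Union>b\<in>B. \<Union>n. \<Union>d\<in>D. {penalized X f b n d})"
      using B(2) D(1) by (intro countable_UN) auto
    then have "countable ?E" by (rule countable_subset[rotated]) blast
    moreover have E: "?E \<subseteq> topspace (Cp X)" using f B(1) D(2) by (auto intro!: penalized_in_Cp)
    moreover have "Cp X closure_of ?E = topspace (Cp X)"
      by (rule penalized_dense[OF X D(2,3) B(1,3) a])
    ultimately have "sequentially_dense_in (Cp X) ?E"
      using sss unfolding strongly_sequentially_separable_def by blast
    moreover have z: "(\<lambda>x\<in>topspace X. 0) \<in> topspace (Cp X)" by (intro restrict_in_Cp) auto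
    ultimately obtain \<tau> where \<tau>: "range \<tau> \<subseteq> ?E"
      "limitin (Cp X) \<tau> (\<lambda>x\<in>topspace X. 0) sequentially"
      unfolding sequentially_dense_in_def by blast
    have \<tau>0: "(\<lambda>j. \<tau> j x) \<longlonglongrightarrow> 0" if "x \<in> topspace X" for x
      using \<tau> limitin_Cp_sequentially[of \<tau> X "\<lambda>x\<in>topspace X. 0"] E z that by auto
    have "\<exists>b n d. \<tau> j = penalized X f b n d \<and> b \<in> B \<and> d \<in> D \<and> d (a n) > 1" for j
      using \<tau>(1) by blast
    then obtain b N d where e: "\<And>j. \<tau> j = penalized X f (b j) (N j) (d j)" "\<And>j. b j \<in> B"
      "\<And>j. d j (a (N j)) > 1" by metis
    have small: "\<forall>\<^sub>F j in sequentially. \<tau> j x < 1" if "x \<in> topspace X" for x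
      using order_tendstoD(2)[OF \<tau>0[OF that], of 1] by simp
    \<comment> \<open>If \<open>N j = n\<close>, then \<open>\<tau> j (a n)\<close> is a convex
      combination of 1 and a number above 1, hence at least 1.\<close>
    have neq: "\<forall>\<^sub>F j in sequentially. N j \<noteq> n" for n
    proof -
      have an: "a n \<in> topspace X" using a by auto
      show ?thesis
        using small[OF an]
      proof eventually_elim
        case (elim j)
        show ?case
        proof
          assume n: "N j = n"
          define m where "m = min 1 (real n * \<bar>b j (a n) - f (a n)\<bar>)"
          have "\<tau> j (a n) = d j (a n) * (1 - m) + m"
            using an by (simp add: e(1) n penalized_def m_def)
          moreover have "1 - m \<le> d j (a n) * (1 - m)"
            using e(3)[of j] n mult_right_mono[of 1 "d j (a n)" "1 - m"] by (simp add: m_def)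
          ultimately show False using elim by linarith
        qed
      qed
    qed
    have "filterlim N at_top sequentially"
      unfolding filterlim_at_top
    proof
      fix k
      have "\<forall>\<^sub>F j in sequentially. \<forall>n\<in>{..<k}. N j \<noteq> n"
        using neq by (intro eventually_ball_finite) auto
      then show "\<forall>\<^sub>F j in sequentially. k \<le> N j"
        by eventually_elim (metis lessThan_iff linorder_not_le)
    qed
    moreover have "\<forall>\<^sub>F j in sequentially. real (N j) * \<bar>b j x - f x\<bar> < 1"
      if x: "x \<in> topspace X" for x
      using small[OF x]
    proof eventually_elim
      case (elim j)
      show ?case
      proof (rule ccontr)
        assume "\<not> ?thesis"
        then have "\<tau> j x = 1" using x by (simp add: e(1) penalized_def)
        then show False using elim by simp
      qed
    qed
    ultimately show ?thesis using lim e(2) by blast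
  qed
qed

section \<open>Continuity of s-continuous functions\<close>

lemma s_continuous_limitin:
  assumes "s_continuous Z f" "range \<sigma> \<subseteq> topspace Z" "limitin Z \<sigma> z sequentially"
  shows "(\<lambda>n. f (\<sigma> n)) \<longlonglongrightarrow> f z"
proof -
  have "continuous_map (subtopology Z (insert z (range \<sigma>))) euclideanreal f"
    using assms unfolding s_continuous_def by blast
  moreover have "limitin (subtopology Z (insert z (range \<sigma>))) \<sigma> z sequentially"
    using assms by (simp add: limitin_subtopology)
  ultimately have "limitin euclideanreal (f \<circ> \<sigma>) (f z) sequentially"
    by (rule continuous_map_limit)
  then show ?thesis by (simp add: o_def)
qed

text \<open>It suffices that \<open>f\<close> is continuous on \<open>D \<union> {z}\<close> for every \<open>z\<close>, where \<open>D\<close> is a countable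
  dense set: since the reals are regular, this implies continuity.\<close>

lemma s_R_space_Cp:
  assumes X: "tychonoff_space X" and sss: "strongly_sequentially_separable (Cp X)"
  shows "s_R_space (Cp X)"
  unfolding s_R_space_def
proof (intro allI impI)
  fix F assume F: "s_continuous (Cp X) F"
  let ?Z = "Cp X"
  have cl: "F z \<in> S" if A: "A \<subseteq> topspace ?Z" "countable A" "z \<in> ?Z closure_of A" and S: "F ` A \<subseteq> S" "closed S"
    for z A S
  proof -
    obtain \<sigma> where \<sigma>: "range \<sigma> \<subseteq> A" "limitin ?Z \<sigma> z sequentially"
      using Cp_closure_of_countable_sequence[OF X sss A] by blast
    then have "(\<lambda>n. F (\<sigma> n)) \<longlonglongrightarrow> F z" using A(1) by (intro s_continuous_limitin[OF F]) auto
    moreover have "F (\<sigma> n) \<in> S" for n using \<sigma>(1) S(1) by auto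
    ultimately show ?thesis using closed_sequentially[OF S(2), of "\<lambda>n. F (\<sigma> n)"] by blast
  qed
  obtain D where D: "countable D" "D \<subseteq> topspace ?Z" "?Z closure_of D = topspace ?Z"
    using sss unfolding strongly_sequentially_separable_def separable_space_def by blast
  have nbhd: "\<exists>U. openin ?Z U \<and> z \<in> U \<and> (\<forall>y\<in>U. F y \<in> W)"
    if z: "z \<in> topspace ?Z" and W: "open W" "F z \<in> W" for z W
  proof -
    \<comment> \<open>A closed ball inside \<open>W\<close>: only closed conditions pass from
      \<open>U \<inter> D\<close> to its closure, which contains \<open>U\<close>.\<close>
    obtain e where e: "e > 0" "cball (F z) e \<subseteq> W" using W open_contains_cball by blast
    define A where "A = {d \<in> D. F d \<notin> ball (F z) e}"
    have "z \<notin> ?Z closure_of A"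
    proof
      assume "z \<in> ?Z closure_of A"
      then have "F z \<in> - ball (F z) e"
        by (rule cl[rotated 2]) (use D in \<open>auto simp: A_def closed_Compl intro: countable_subset[of _ D]\<close>)
      then show False using e by simp
    qed
    then obtain U where U: "openin ?Z U" "z \<in> U" "U \<inter> A = {}"
      using z unfolding in_closure_of by blast
    have "F y \<in> W" if y: "y \<in> U" for y
    proof -
      have "y \<in> ?Z closure_of D" using y openin_subset[OF U(1)] D(3) by auto
      then have "y \<in> ?Z closure_of (U \<inter> D)"
        using y openin_Int_closure_of_subset[OF U(1)] by blast
      then have "F y \<in> cball (F z) e"
        by (rule cl[rotated 2]) (use D U(3) in \<open>auto simp: A_def\<close>)
      then show ?thesis using e by blast
    qed
    then show ?thesis using U by blast
  qed
  show "continuous_map ?Z euclideanreal F"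
    unfolding continuous_map_def
  proof (intro conjI allI impI)
    fix W assume "openin euclideanreal W"
    then show "openin ?Z {x \<in> topspace ?Z. F x \<in> W}"
      unfolding openin_subopen[of _ "{x \<in> topspace ?Z. F x \<in> W}"]
      using nbhd openin_subset by (smt (verit) mem_Collect_eq open_openin subset_iff)
  qed auto
qed

section \<open>Countable tightness and Lindelof finite powers\<close>

text \<open>For fixed \<open>n\<close> and \<open>m\<close>, the tuples on whose entries
  \<open>a\<close> is \<open>1 / Suc m\<close>-close to \<open>f\<close> form an open set, and as
  \<open>a\<close> runs through \<open>A\<close> these sets cover \<open>X^n\<close> because
  \<open>f\<close> is in the closure. Countable subcovers for all \<open>n\<close> and
  \<open>m\<close> together select the required countable subset of \<open>A\<close>.\<close>

lemma countable_tightness_Cp: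
  assumes L: "\<And>n. Lindelof_space (finite_power X n)"
  shows "countable_tightness (Cp X)"
  unfolding countable_tightness_def
proof (intro allI impI)
  fix A f assume "A \<subseteq> topspace (Cp X) \<and> f \<in> Cp X closure_of A"
  then have A: "A \<subseteq> topspace (Cp X)" and fA: "f \<in> Cp X closure_of A" by auto
  have f: "f \<in> topspace (Cp X)" using fA by (simp add: in_closure_of)
  define G where "G n m a = {t \<in> topspace (finite_power X n). \<forall>i\<in>{..<n}. \<bar>a (t i) - f (t i)\<bar> < 1 / real (Suc m)}"
    for n m a
  have G: "openin (finite_power X n) (G n m a)" if "a \<in> A" for n m a
  proof -
    have a: "a \<in> topspace (Cp X)" using A that by auto
    have "openin (finite_power X n) {t \<in> topspace (finite_power X n). \<bar>a (t i) - f (t i)\<bar> < 1 / real (Suc m)}"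
      if "i < n" for i
    proof -
      have p: "continuous_map (finite_power X n) X (\<lambda>t. t i)"
        unfolding finite_power_def using that by (intro continuous_map_product_coordinates) auto
      have "continuous_map (finite_power X n) euclideanreal (\<lambda>t. \<bar>a (t i) - f (t i)\<bar>)"
        using continuous_map_compose[OF p Cp_continuous[OF a]] continuous_map_compose[OF p Cp_continuous[OF f]]
        by (intro continuous_intros) (auto simp: o_def)
      then have "openin (finite_power X n) {t \<in> topspace (finite_power X n). \<bar>a (t i) - f (t i)\<bar> \<in> {..<1 / real (Suc m)}}"
        by (rule openin_continuous_map_preimage) auto
      then show ?thesis by simp
    qed
    then have "openin (finite_power X n)
      (topspace (finite_power X n) \<inter>
       (\<Inter>i\<in>{..<n}. {t \<in> topspace (finite_power X n). \<bar>a (t i) - f (t i)\<bar> < 1 / real (Suc m)}))"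
      by (intro openin_Int_Inter) auto
    then show ?thesis by (rule back_subst[of "openin (finite_power X n)"]) (auto simp: G_def)
  qed
  have "\<exists>C\<subseteq>A. countable C \<and> topspace (finite_power X n) \<subseteq> (\<Union>a\<in>C. G n m a)" for n m
  proof -
    have "topspace (finite_power X n) \<subseteq> \<Union>(G n m ` A)"
    proof
      fix t assume t: "t \<in> topspace (finite_power X n)"
      then have "finite (t ` {..<n})" "t ` {..<n} \<subseteq> topspace X" "0 < 1 / real (Suc m)"
        by (auto simp: finite_power_def)
      then obtain a where "a \<in> A" "\<forall>x\<in>t ` {..<n}. \<bar>a x - f x\<bar> < 1 / real (Suc m)"
        using fA unfolding in_closure_of_Cp[OF A] by blast
      then show "t \<in> \<Union>(G n m ` A)" using t by (auto simp: G_def)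
    qed
    moreover have "\<forall>U\<in>G n m ` A. openin (finite_power X n) U" using G by blast
    ultimately obtain V where "countable V" "V \<subseteq> G n m ` A" "topspace (finite_power X n) \<subseteq> \<Union>V"
      using L[of n, unfolded Lindelof_space_alt, rule_format, of "G n m ` A"] by blast
    then show ?thesis by (metis countable_subset_image)
  qed
  then obtain C where C: "\<And>n m. C n m \<subseteq> A" "\<And>n m. countable (C n m)"
    "\<And>n m. topspace (finite_power X n) \<subseteq> (\<Union>a\<in>C n m. G n m a)"
    by metis
  define B where "B = (\<Union>n m. C n m)"
  have BA: "B \<subseteq> A" using C(1) by (auto simp: B_def)
  have "\<exists>b\<in>B. \<forall>x\<in>K. \<bar>b x - f x\<bar> < e" if K: "finite K" "K \<subseteq> topspace X" "0 < e" for K e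
  proof -
    obtain m where m: "1 / real (Suc m) < e" using K(3) nat_approx_posE by (metis)
    \<comment> \<open>An enumeration of \<open>K\<close> turns it into a single point of
      \<open>X^n\<close>. For empty \<open>K\<close>, \<open>n = 0\<close> and covering the one
      point of \<open>X^0\<close> still supplies some \<open>b\<close>.\<close>
    obtain n and s :: "nat \<Rightarrow> 'a" where s: "K = s ` {i. i < n}"
      using finite_imp_nat_seg_image_inj_on[OF K(1)] by metis
    let ?t = "restrict s {..<n}"
    have "?t \<in> topspace (finite_power X n)" using K(2) s by (auto simp: finite_power_def)
    then obtain b where b: "b \<in> C n m" "?t \<in> G n m b" using C(3) by blast
    have "\<bar>b x - f x\<bar> < e" if x: "x \<in> K" for x
    proof -
      obtain i where "i < n" "x = ?t i" using x s by auto
      then have "\<bar>b x - f x\<bar> < 1 / real (Suc m)" using b(2) by (auto simp: G_def)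
      then show ?thesis using m by linarith
    qed
    then show ?thesis using b(1) by (auto simp: B_def)
  qed
  then have "f \<in> Cp X closure_of B"
    unfolding in_closure_of_Cp[OF subset_trans[OF BA A]] using f by blast
  moreover have "countable B" using C(2) by (auto simp: B_def)
  ultimately show "\<exists>B. B \<subseteq> A \<and> countable B \<and> f \<in> Cp X closure_of B" using BA by blast
qed

text \<open>A tube lemma: the finitely many tuples over \<open>K\<close> each have an open box
  inside \<open>W\<close>, and intersecting box sides gives one open set usable in every
  coordinate.\<close>

lemma finite_power_tube:
  assumes "finite K" "K \<subseteq> topspace X" "openin (finite_power X n) W" "PiE {..<n} (\<lambda>_. K) \<subseteq> W"
  obtains V where "openin X V" "K \<subseteq> V" "PiE {..<n} (\<lambda>_. V) \<subseteq> W"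
proof -
  let ?P = "PiE {..<n} (\<lambda>_. K)"
  have finP: "finite ?P" using assms(1) by (intro finite_PiE) auto
  have "\<exists>U. (\<forall>i\<in>{..<n}. openin X (U i)) \<and> t \<in> PiE {..<n} U \<and> PiE {..<n} U \<subseteq> W" if "t \<in> ?P" for t
  proof -
    have "t \<in> W" using assms(4) that by blast
    then show ?thesis
      using assms(3)[unfolded finite_power_def openin_product_topology_alt, rule_format] by blast
  qed
  then have "\<forall>t\<in>?P. \<exists>U. (\<forall>i\<in>{..<n}. openin X (U i)) \<and> t \<in> PiE {..<n} U \<and> PiE {..<n} U \<subseteq> W"
    by (intro ballI)
  from bchoice[OF this] obtain U where U': "\<forall>t\<in>?P. (\<forall>i\<in>{..<n}. openin X (U t i)) \<and>
      t \<in> PiE {..<n} (U t) \<and> PiE {..<n} (U t) \<subseteq> W" ..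
  have U: "\<And>t i. t \<in> ?P \<Longrightarrow> i < n \<Longrightarrow> openin X (U t i)"
    "\<And>t. t \<in> ?P \<Longrightarrow> t \<in> PiE {..<n} (U t)" "\<And>t. t \<in> ?P \<Longrightarrow> PiE {..<n} (U t) \<subseteq> W"
    using bspec[OF U'] by (simp_all only: lessThan_iff Ball_def)
  \<comment> \<open>Intersects the sides of all boxes at the positions where \<open>x\<close> occurs
    in a tuple; \<open>topspace X\<close> is the value when there is no such position.\<close>
  define N where "N x = topspace X \<inter> (\<Inter>(t, i)\<in>{(t, i). t \<in> ?P \<and> i < n \<and> t i = x}. U t i)" for x
  have fin: "finite {(t, i). t \<in> ?P \<and> i < n \<and> t i = x}" for x
    by (rule finite_subset[of _ "?P \<times> {..<n}"]) (use finP in auto)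
  have oN: "openin X (N x)" for x
    unfolding N_def using fin[of x] U(1) by (intro openin_Int_Inter) auto
  have xN: "x \<in> N x" if "x \<in> K" for x
    unfolding N_def
  proof (intro IntI INT_I)
    show "x \<in> topspace X" using that assms(2) by blast
    fix p assume "p \<in> {(t, i). t \<in> ?P \<and> i < n \<and> t i = x}"
    then obtain t i where p: "p = (t, i)" "t \<in> ?P" "i < n" "t i = x" by blast
    have "t i \<in> U t i" using U(2)[OF p(2)] p(3) by (auto simp: PiE_iff)
    then show "x \<in> (case p of (t, i) \<Rightarrow> U t i)" using p by simp
  qed
  show thesis
  proof
    show "openin X (\<Union>x\<in>K. N x)" using oN by (intro openin_Union) auto
    show "K \<subseteq> (\<Union>x\<in>K. N x)" using xN by blast
    show "PiE {..<n} (\<lambda>_. \<Union>x\<in>K. N x) \<subseteq> W"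
    proof
      fix y assume y: "y \<in> PiE {..<n} (\<lambda>_. \<Union>x\<in>K. N x)"
      then have "\<forall>i\<in>{..<n}. \<exists>x\<in>K. y i \<in> N x" by (auto simp: PiE_iff)
      then obtain s where s: "\<And>i. i < n \<Longrightarrow> s i \<in> K \<and> y i \<in> N (s i)" by (metis lessThan_iff)
      \<comment> \<open>The tuple over \<open>K\<close> whose box contains \<open>y\<close>: each
        \<open>y i\<close> lies in \<open>N (s i)\<close>, which is contained in the side of that
        box at \<open>i\<close>.\<close>
      let ?t = "restrict s {..<n}"
      have t: "?t \<in> ?P" using s by auto
      have "y i \<in> U ?t i" if "i < n" for i
      proof -
        have "(?t, i) \<in> {(t, i'). t \<in> ?P \<and> i' < n \<and> t i' = s i}" using t that by simp
        then show ?thesis using s[OF that] unfolding N_def by blast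
      qed
      then have "y \<in> PiE {..<n} (U ?t)" using y by (auto simp: PiE_iff)
      then show "y \<in> W" using U(3)[OF t] by blast
    qed
  qed
qed

text \<open>Call an open \<open>V\<close> good if \<open>V\<^sup>n\<close> is covered by a finite part of the given cover. The
  constant \<open>1\<close> is a limit of functions vanishing outside good sets. Wherever countably many of
  them have \<open>1\<close> as a limit, the \<open>n\<close>-th powers of their good sets cover \<open>X\<^sup>n\<close>.\<close>

lemma Lindelof_finite_power:
  assumes X: "tychonoff_space X" and ct: "countable_tightness (Cp X)"
  shows "Lindelof_space (finite_power X n)"
  unfolding Lindelof_space_alt
proof (intro allI impI)
  fix \<W> assume "(\<forall>W\<in>\<W>. openin (finite_power X n) W) \<and> topspace (finite_power X n) \<subseteq> \<Union>\<W>"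
  then have W: "\<And>W. W \<in> \<W> \<Longrightarrow> openin (finite_power X n) W" "topspace (finite_power X n) \<subseteq> \<Union>\<W>"
    by auto
  define good where "good V \<F> \<longleftrightarrow> openin X V \<and> finite \<F> \<and> \<F> \<subseteq> \<W> \<and> PiE {..<n} (\<lambda>_. V) \<subseteq> \<Union>\<F>"
    for V \<F>
  define A where "A = {g \<in> topspace (Cp X). \<exists>V \<F>. good V \<F> \<and> (\<forall>x\<in>topspace X - V. g x = 0)}"
  define one :: "'a \<Rightarrow> real" where "one = (\<lambda>x\<in>topspace X. 1)"
  have A: "A \<subseteq> topspace (Cp X)" by (auto simp: A_def)
  have one: "one \<in> topspace (Cp X)" unfolding one_def by (intro restrict_in_Cp) auto
  have "\<exists>g\<in>A. \<forall>x\<in>K. \<bar>g x - one x\<bar> < e" if K: "finite K" "K \<subseteq> topspace X" "0 < e" for K e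
  proof -
    let ?P = "PiE {..<n} (\<lambda>_. K)"
    have "finite ?P" using K(1) by (intro finite_PiE) auto
    moreover have "?P \<subseteq> topspace (finite_power X n)"
      using K(2) by (simp add: finite_power_def PiE_mono)
    then have "?P \<subseteq> \<Union>\<W>" using W(2) by (rule subset_trans)
    ultimately obtain \<F> where F: "finite \<F>" "\<F> \<subseteq> \<W>" "?P \<subseteq> \<Union>\<F>"
      by (rule finite_subset_Union)
    then have "openin (finite_power X n) (\<Union>\<F>)" using W(1) by (intro openin_Union) blast
    then obtain V where V: "openin X V" "K \<subseteq> V" "PiE {..<n} (\<lambda>_. V) \<subseteq> \<Union>\<F>"
      using finite_power_tube[OF K(1,2) _ F(3)] by blast
    obtain u :: "'a \<Rightarrow> real" where u: "continuous_map X euclideanreal u"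
      "\<And>x. x \<in> K \<Longrightarrow> u x = 1" "\<And>x. x \<in> topspace X - V \<Longrightarrow> u x = 0"
      using completely_regular_finite_separation[of X "topspace X - V" K] X V K
      unfolding tychonoff_space_def by blast
    have "restrict u (topspace X) \<in> A"
    proof -
      have "good V \<F>" using V F unfolding good_def by blast
      moreover have "\<forall>x\<in>topspace X - V. restrict u (topspace X) x = 0" using u(3) by simp
      ultimately show ?thesis using restrict_in_Cp[OF u(1)] unfolding A_def by blast
    qed
    moreover have "\<forall>x\<in>K. \<bar>restrict u (topspace X) x - one x\<bar> < e"
      using u(2) K by (auto simp: one_def)
    ultimately show ?thesis by blast
  qed
  then have "one \<in> Cp X closure_of A" unfolding in_closure_of_Cp[OF A] using one by blast
  then obtain B where B: "B \<subseteq> A" "countable B" "one \<in> Cp X closure_of B"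
    using ct A unfolding countable_tightness_def by blast
  have "\<forall>g\<in>B. \<exists>V \<F>. good V \<F> \<and> (\<forall>x\<in>topspace X - V. g x = 0)" using B(1) by (auto simp: A_def)
  then obtain V \<F> where VF: "\<And>g. g \<in> B \<Longrightarrow> good (V g) (\<F> g)"
    "\<And>g x. g \<in> B \<Longrightarrow> x \<in> topspace X - V g \<Longrightarrow> g x = 0" by metis
  have "topspace (finite_power X n) \<subseteq> \<Union>(\<Union>g\<in>B. \<F> g)"
  proof
    fix t assume t: "t \<in> topspace (finite_power X n)"
    then have K: "finite (t ` {..<n})" "t ` {..<n} \<subseteq> topspace X" by (auto simp: finite_power_def)
    have BC: "B \<subseteq> topspace (Cp X)" using B(1) A by blast
    \<comment> \<open>Radius 1 suffices: a function vanishing at a point of \<open>X\<close> is at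
      distance exactly 1 from \<open>one\<close> there, so every \<open>t i\<close> must lie in
      \<open>V g\<close>.\<close>
    obtain g where g: "g \<in> B" "\<forall>x\<in>t ` {..<n}. \<bar>g x - one x\<bar> < 1"
      using B(3) K zero_less_one unfolding in_closure_of_Cp[OF BC] by blast
    have "t i \<in> V g" if "i < n" for i
    proof (rule ccontr)
      assume "t i \<notin> V g"
      then have "g (t i) = 0" "one (t i) = 1" using VF(2)[OF g(1)] K(2) that by (auto simp: one_def)
      then show False using g(2) that by force
    qed
    then have "t \<in> PiE {..<n} (\<lambda>_. V g)" using t by (auto simp: finite_power_def PiE_iff)
    then show "t \<in> \<Union>(\<Union>g\<in>B. \<F> g)" using VF(1)[OF g(1)] g(1) unfolding good_def by blast
  qed
  moreover have "countable (\<Union>g\<in>B. \<F> g)"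
    using B(2) VF(1) by (intro countable_UN) (auto simp: good_def countable_finite)
  moreover have "(\<Union>g\<in>B. \<F> g) \<subseteq> \<W>" using VF(1) by (auto simp: good_def)
  ultimately show "\<exists>\<V>. countable \<V> \<and> \<V> \<subseteq> \<W> \<and> topspace (finite_power X n) \<subseteq> \<Union>\<V>" by blast
qed

section \<open>The Frechet-Urysohn property and the conclusion\<close>

lemma Frechet_Urysohn_imp_countable_tightness:
  assumes "Frechet_Urysohn_space Z"
  shows "countable_tightness Z"
  unfolding countable_tightness_def
proof (intro allI impI)
  fix A x assume A: "A \<subseteq> topspace Z \<and> x \<in> Z closure_of A"
  then obtain \<sigma> where \<sigma>: "range \<sigma> \<subseteq> A" "limitin Z \<sigma> x sequentially"
    using assms unfolding Frechet_Urysohn_space_def by blast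
  then have "x \<in> Z closure_of (range \<sigma>)"
    unfolding in_closure_of limitin_def eventually_sequentially by blast
  then show "\<exists>B. B \<subseteq> A \<and> countable B \<and> x \<in> Z closure_of B"
    using \<sigma>(1) by blast
qed

theorem theorem11p15:
  fixes X :: "'a topology"
  assumes "tychonoff_space X"
    and "strongly_sequentially_separable (Cp X)"
  shows "s_R_space (Cp X) \<and>
    ((\<forall>n. Lindelof_space (finite_power X n)) \<longleftrightarrow> countable_tightness (Cp X)) \<and>
    (countable_tightness (Cp X) \<longleftrightarrow> Frechet_Urysohn_space (Cp X))"
proof (intro conjI)
  show "s_R_space (Cp X)" using assms by (rule s_R_space_Cp)
  show "(\<forall>n. Lindelof_space (finite_power X n)) \<longleftrightarrow> countable_tightness (Cp X)"
    using countable_tightness_Cp[of X] Lindelof_finite_power[OF assms(1)] by blast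
  have "Frechet_Urysohn_space (Cp X)" if ct: "countable_tightness (Cp X)"
    unfolding Frechet_Urysohn_space_def
  proof (intro allI impI)
    fix A f assume A: "A \<subseteq> topspace (Cp X) \<and> f \<in> Cp X closure_of A"
    then obtain B where "B \<subseteq> A" "countable B" "f \<in> Cp X closure_of B"
      using ct unfolding countable_tightness_def by blast
    then show "\<exists>\<sigma>. range \<sigma> \<subseteq> A \<and> limitin (Cp X) \<sigma> f sequentially"
      using Cp_closure_of_countable_sequence[OF assms, of B f] A by blast
  qed
  then show "countable_tightness (Cp X) \<longleftrightarrow> Frechet_Urysohn_space (Cp X)"
    using Frechet_Urysohn_imp_countable_tightness by blast
qed

end
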